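(* Let $X$ be a small category and $\pi:P\to X$ a category over $X$. Let ${\uparrow}P$ be the discrete opfibration over $X$ whose fiber over $x$ is $\Gamma_!(P/x)$, with action $f[\langle a,\pi a\xrightarrow{h}x\rangle]=[\langle a,\pi a\xrightarrow{fh}y\rangle]$ for $f:x\to y$ in $X$. Then the assignment taking an object $a$ of $P$ over $x$ to the component $[\langle a,x\xrightarrow{\mathrm{id}}x\rangle]\in\Gamma_!(P/x)$ is the object part of a morphism $\phi_P:P\to{\uparrow}P$ in $\mathbf{Cat}/X$, and $\phi_P$ is a universal morphism from $P$ to a discrete opfibration: for every discrete opfibration $D$ over $X$ and every morphism $\phi:P\to D$ in $\mathbf{Cat}/X$ there is a unique morphism $\overline{\phi}:{\uparrow}P\to D$ in $\mathbf{Cat}/X$ with $\overline{\phi}\circ\phi_P=\phi$. So the formula $({\uparrow}P)x=\mathrm{ten}(X/x,P)$ gives indeed the reflection of $P$ in discrete opfibrations.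
   Context: $\mathbf{Cat}/X$ is the slice category: objects ("categories over $X$") are functors $\pi:P\to X$ with $P$ small, morphisms are functors commuting with the projections to $X$. A category $\pi:D\to X$ over $X$ is a discrete opfibration if for every object $a$ of $D$ and every arrow $f:\pi a\to y$ of $X$ there is a unique arrow of $D$ with domain $a$ lying over $f$; a discrete opfibration with fibers $Dx$ corresponds to a functor $X\to\mathbf{Set}$, $x\mapsto Dx$, the action of $f$ sending $a$ to the codomain of the unique lift. $\Gamma_!$ is the set of connected components of a category. $P/x$ is the comma category whose objects are pairs $\langle a,\pi a\xrightarrow{h}x\rangle$, with $a$ an object of $P$; an arrow $\langle a,h\rangle\to\langle b,k\rangle$ is an arrow $u:a\to b$ of $P$ with $k\circ\pi u=h$. $[-]$ denotes the component of an object. $\mathrm{ten}(P,Q)$ is the set of connected components of the product $P\times Q$ in $\mathbf{Cat}/X$ (the pullback $P\times_XQ$); thus $\mathrm{ten}(X/x,P)=\Gamma_!(P/x)$. *)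

theory Defs
  imports Main "HOL-Library.FuncSet"
begin

section \<open>Small categories and functors\<close>

text \<open>
  Objects and arrows form sets, so every category below is small. The operations are only
  meaningful on \<open>Obj C\<close> and on (composable) elements of \<open>Arr C\<close>; \<open>g \<cdot>\<^bsub>C\<^esub> f\<close> is \<open>g\<close> after \<open>f\<close>.
\<close>

record ('o, 'a) cat =
  Obj :: "'o set"
  Arr :: "'a set"
  Dom :: "'a \<Rightarrow> 'o"
  Cod :: "'a \<Rightarrow> 'o"
  Ident :: "'o \<Rightarrow> 'a"
  Comp :: "'a \<Rightarrow> 'a \<Rightarrow> 'a" (infixl \<open>\<cdot>\<index>\<close> 70)

locale category =
  fixes C :: "('o, 'a, 'm) cat_scheme" (structure)
  assumes Dom_closed: "f \<in> Arr C \<Longrightarrow> Dom C f \<in> Obj C"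
    and Cod_closed: "f \<in> Arr C \<Longrightarrow> Cod C f \<in> Obj C"
    and Ident_closed: "a \<in> Obj C \<Longrightarrow> Ident C a \<in> Arr C"
    and Dom_Ident: "a \<in> Obj C \<Longrightarrow> Dom C (Ident C a) = a"
    and Cod_Ident: "a \<in> Obj C \<Longrightarrow> Cod C (Ident C a) = a"
    and Comp_closed: "\<lbrakk>f \<in> Arr C; g \<in> Arr C; Dom C g = Cod C f\<rbrakk> \<Longrightarrow> g \<cdot> f \<in> Arr C"
    and Dom_Comp: "\<lbrakk>f \<in> Arr C; g \<in> Arr C; Dom C g = Cod C f\<rbrakk> \<Longrightarrow> Dom C (g \<cdot> f) = Dom C f"
    and Cod_Comp: "\<lbrakk>f \<in> Arr C; g \<in> Arr C; Dom C g = Cod C f\<rbrakk> \<Longrightarrow> Cod C (g \<cdot> f) = Cod C g"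
    and Comp_Ident: "f \<in> Arr C \<Longrightarrow> f \<cdot> Ident C (Dom C f) = f"
    and Ident_Comp: "f \<in> Arr C \<Longrightarrow> Ident C (Cod C f) \<cdot> f = f"
    and Comp_assoc: "\<lbrakk>f \<in> Arr C; g \<in> Arr C; h \<in> Arr C; Dom C g = Cod C f; Dom C h = Cod C g\<rbrakk>
      \<Longrightarrow> (h \<cdot> g) \<cdot> f = h \<cdot> (g \<cdot> f)"

text \<open>
  The two maps of a functor are extensional (\<open>undefined\<close> outside their domains), so that HOL
  equality of functors is equality of functors in the mathematical sense.
\<close>

record ('o, 'a, 'p, 'b) fctr =
  omap :: "'o \<Rightarrow> 'p"
  amap :: "'a \<Rightarrow> 'b"

definition is_functor ::
  "('o, 'a, 'm) cat_scheme \<Rightarrow> ('p, 'b, 'n) cat_scheme \<Rightarrow> ('o, 'a, 'p, 'b) fctr \<Rightarrow> bool" where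
  "is_functor C D F \<longleftrightarrow>
     omap F \<in> Obj C \<rightarrow>\<^sub>E Obj D \<and>
     amap F \<in> Arr C \<rightarrow>\<^sub>E Arr D \<and>
     (\<forall>f\<in>Arr C. Dom D (amap F f) = omap F (Dom C f) \<and> Cod D (amap F f) = omap F (Cod C f)) \<and>
     (\<forall>a\<in>Obj C. amap F (Ident C a) = Ident D (omap F a)) \<and>
     (\<forall>f\<in>Arr C. \<forall>g\<in>Arr C. Dom C g = Cod C f \<longrightarrow> amap F (g \<cdot>\<^bsub>C\<^esub> f) = amap F g \<cdot>\<^bsub>D\<^esub> amap F f)"

definition id_functor :: "('o, 'a, 'm) cat_scheme \<Rightarrow> ('o, 'a, 'o, 'a) fctr" where
  "id_functor C = \<lparr>omap = (\<lambda>a\<in>Obj C. a), amap = (\<lambda>f\<in>Arr C. f)\<rparr>"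

text \<open>\<open>comp_functor C G F\<close> is \<open>G\<close> after \<open>F\<close>, where \<open>C\<close> is the source of \<open>F\<close>.\<close>

definition comp_functor ::
  "('o, 'a, 'm) cat_scheme \<Rightarrow> ('p, 'b, 'q, 'c) fctr \<Rightarrow> ('o, 'a, 'p, 'b) fctr \<Rightarrow> ('o, 'a, 'q, 'c) fctr"
where
  "comp_functor C G F =
     \<lparr>omap = compose (Obj C) (omap G) (omap F), amap = compose (Arr C) (amap G) (amap F)\<rparr>"


section \<open>Connected components\<close>

definition connected_rel :: "('o, 'a, 'm) cat_scheme \<Rightarrow> 'o rel" where
  "connected_rel C = (let r = {(Dom C f, Cod C f) | f. f \<in> Arr C} in (r \<union> r\<inverse>)\<^sup>*)"

definition component :: "('o, 'a, 'm) cat_scheme \<Rightarrow> 'o \<Rightarrow> 'o set" where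
  "component C a = connected_rel C `` {a}"

definition components :: "('o, 'a, 'm) cat_scheme \<Rightarrow> 'o set set" where
  "components C = Obj C // connected_rel C"


section \<open>The slice category of categories over a base\<close>

record ('o, 'a, 'xo, 'xa) over = "('o, 'a) cat" +
  proj :: "('o, 'a, 'xo, 'xa) fctr"

definition category_over :: "('xo, 'xa) cat \<Rightarrow> ('o, 'a, 'xo, 'xa) over \<Rightarrow> bool" where
  "category_over X P \<longleftrightarrow> category P \<and> is_functor P X (proj P)"

definition over_morphism ::
  "('o, 'a, 'xo, 'xa) over \<Rightarrow> ('p, 'b, 'xo, 'xa) over \<Rightarrow> ('o, 'a, 'p, 'b) fctr \<Rightarrow> bool" where
  "over_morphism P Q F \<longleftrightarrow> is_functor P Q F \<and> comp_functor P (proj Q) F = proj P"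

definition discrete_opfibration :: "('xo, 'xa) cat \<Rightarrow> ('o, 'a, 'xo, 'xa) over \<Rightarrow> bool" where
  "discrete_opfibration X D \<longleftrightarrow> category_over X D \<and>
     (\<forall>a\<in>Obj D. \<forall>f\<in>Arr X. Dom X f = omap (proj D) a \<longrightarrow>
        (\<exists>!u. u \<in> Arr D \<and> Dom D u = a \<and> amap (proj D) u = f))"

definition fiber :: "('o, 'a, 'xo, 'xa) over \<Rightarrow> 'xo \<Rightarrow> 'o set" where
  "fiber D x = {a \<in> Obj D. omap (proj D) a = x}"

definition transport :: "('o, 'a, 'xo, 'xa) over \<Rightarrow> 'xa \<Rightarrow> 'o \<Rightarrow> 'o" where
  "transport D f a = Cod D (THE u. u \<in> Arr D \<and> Dom D u = a \<and> amap (proj D) u = f)"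

text \<open>
  The comma category \<open>P/x\<close>. An arrow carries its source and its target, since the arrow
  \<open>u\<close> of \<open>P\<close> alone does not determine them. It is regarded as a category over \<open>X\<close> along
  \<open>P/x \<rightarrow> P \<rightarrow> X\<close>.
\<close>

definition comma :: "('xo, 'xa) cat \<Rightarrow> ('o, 'a, 'xo, 'xa) over \<Rightarrow> 'xo \<Rightarrow>
    ('o \<times> 'xa, ('o \<times> 'xa) \<times> 'a \<times> ('o \<times> 'xa), 'xo, 'xa) over" where
  "comma X P x = (let
      Ob = {(a, h). a \<in> Obj P \<and> h \<in> Arr X \<and> Dom X h = omap (proj P) a \<and> Cod X h = x};
      Ar = {((a, h), u, (b, k)). (a, h) \<in> Ob \<and> (b, k) \<in> Ob \<and> u \<in> Arr P \<and>
              Dom P u = a \<and> Cod P u = b \<and> k \<cdot>\<^bsub>X\<^esub> amap (proj P) u = h}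
    in \<lparr>Obj = Ob,
        Arr = Ar,
        Dom = (\<lambda>(s, u, t). s),
        Cod = (\<lambda>(s, u, t). t),
        Ident = (\<lambda>(a, h). ((a, h), Ident P a, (a, h))),
        Comp = (\<lambda>(s', v, t') (s, u, t). (s, v \<cdot>\<^bsub>P\<^esub> u, t')),
        proj = \<lparr>omap = (\<lambda>(a, h)\<in>Ob. omap (proj P) a), amap = (\<lambda>(s, u, t)\<in>Ar. amap (proj P) u)\<rparr>\<rparr>)"

definition base_over :: "('xo, 'xa) cat \<Rightarrow> ('xo, 'xa, 'xo, 'xa) over" where
  "base_over X = \<lparr>Obj = Obj X, Arr = Arr X, Dom = Dom X, Cod = Cod X, Ident = Ident X, Comp = Comp X,
     proj = id_functor X\<rparr>"

text \<open>\<open>X/x\<close>, whose objects are the pairs \<open>(y, h)\<close> with \<open>h : y \<rightarrow> x\<close>.\<close>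

definition slice :: "('xo, 'xa) cat \<Rightarrow> 'xo \<Rightarrow>
    ('xo \<times> 'xa, ('xo \<times> 'xa) \<times> 'xa \<times> ('xo \<times> 'xa), 'xo, 'xa) over" where
  "slice X x = comma X (base_over X) x"

definition prod_over :: "('o, 'a, 'xo, 'xa) over \<Rightarrow> ('p, 'b, 'xo, 'xa) over \<Rightarrow>
    ('o \<times> 'p, 'a \<times> 'b, 'xo, 'xa) over" where
  "prod_over P Q = (let
      Ob = {(a, b). a \<in> Obj P \<and> b \<in> Obj Q \<and> omap (proj P) a = omap (proj Q) b};
      Ar = {(u, v). u \<in> Arr P \<and> v \<in> Arr Q \<and> amap (proj P) u = amap (proj Q) v}
    in \<lparr>Obj = Ob,
        Arr = Ar,
        Dom = (\<lambda>(u, v). (Dom P u, Dom Q v)),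
        Cod = (\<lambda>(u, v). (Cod P u, Cod Q v)),
        Ident = (\<lambda>(a, b). (Ident P a, Ident Q b)),
        Comp = (\<lambda>(u', v') (u, v). (u' \<cdot>\<^bsub>P\<^esub> u, v' \<cdot>\<^bsub>Q\<^esub> v)),
        proj = \<lparr>omap = (\<lambda>(a, b)\<in>Ob. omap (proj P) a), amap = (\<lambda>(u, v)\<in>Ar. amap (proj P) u)\<rparr>\<rparr>)"

definition ten :: "('o, 'a, 'xo, 'xa) over \<Rightarrow> ('p, 'b, 'xo, 'xa) over \<Rightarrow> ('o \<times> 'p) set set" where
  "ten P Q = components (prod_over P Q)"


section \<open>The discrete opfibration of components\<close>

text \<open>
  The category over \<open>X\<close> with fibers \<open>F x\<close> and action \<open>A f : F (Dom f) \<rightarrow> F (Cod f)\<close>: its objects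
  are pairs \<open>(x, c)\<close> with \<open>c \<in> F x\<close>, and \<open>(f, c)\<close> is the unique arrow over \<open>f\<close> with domain
  \<open>(Dom f, c)\<close>.
\<close>

definition elements :: "('xo, 'xa) cat \<Rightarrow> ('xo \<Rightarrow> 's set) \<Rightarrow> ('xa \<Rightarrow> 's \<Rightarrow> 's) \<Rightarrow>
    ('xo \<times> 's, 'xa \<times> 's, 'xo, 'xa) over" where
  "elements X F A = (let
      Ob = (SIGMA x:Obj X. F x);
      Ar = (SIGMA f:Arr X. F (Dom X f))
    in \<lparr>Obj = Ob,
        Arr = Ar,
        Dom = (\<lambda>(f, c). (Dom X f, c)),
        Cod = (\<lambda>(f, c). (Cod X f, A f c)),
        Ident = (\<lambda>(x, c). (Ident X x, c)),
        Comp = (\<lambda>(g, d) (f, c). (g \<cdot>\<^bsub>X\<^esub> f, c)),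
        proj = \<lparr>omap = (\<lambda>(x, c)\<in>Ob. x), amap = (\<lambda>(f, c)\<in>Ar. f)\<rparr>\<rparr>)"

text \<open>
  \<open>f [(a, h)] = [(a, f h)]\<close>, through an arbitrary representative \<open>(a, h)\<close> of the component \<open>c\<close>.
  The description is proper only because the right-hand side does not depend on it.
\<close>

definition component_action :: "('xo, 'xa) cat \<Rightarrow> ('o, 'a, 'xo, 'xa) over \<Rightarrow> 'xa \<Rightarrow>
    ('o \<times> 'xa) set \<Rightarrow> ('o \<times> 'xa) set" where
  "component_action X P f c =
     (THE d. \<exists>(a, h)\<in>c. d = component (comma X P (Cod X f)) (a, f \<cdot>\<^bsub>X\<^esub> h))"

definition up :: "('xo, 'xa) cat \<Rightarrow> ('o, 'a, 'xo, 'xa) over \<Rightarrow>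
    ('xo \<times> ('o \<times> 'xa) set, 'xa \<times> ('o \<times> 'xa) set, 'xo, 'xa) over" where
  "up X P = elements X (\<lambda>x. components (comma X P x)) (component_action X P)"

text \<open>
  The object part of \<open>\<phi>\<^sub>P\<close> is \<open>a \<mapsto> [(a, id)]\<close>; an arrow \<open>u : a \<rightarrow> b\<close> can only go to the unique
  arrow over its projection with domain \<open>[(a, id)]\<close>.
\<close>

definition unit_obj :: "('xo, 'xa) cat \<Rightarrow> ('o, 'a, 'xo, 'xa) over \<Rightarrow> 'o \<Rightarrow>
    'xo \<times> ('o \<times> 'xa) set" where
  "unit_obj X P a = (let x = omap (proj P) a in (x, component (comma X P x) (a, Ident X x)))"

definition unit_morphism :: "('xo, 'xa) cat \<Rightarrow> ('o, 'a, 'xo, 'xa) over \<Rightarrow>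
    ('o, 'a, 'xo \<times> ('o \<times> 'xa) set, 'xa \<times> ('o \<times> 'xa) set) fctr" where
  "unit_morphism X P =
     \<lparr>omap = (\<lambda>a\<in>Obj P. unit_obj X P a),
      amap = (\<lambda>u\<in>Arr P. (amap (proj P) u, snd (unit_obj X P (Dom P u))))\<rparr>"

end

theory Submission
  imports Defs
begin

text \<open>
  The pair \<open>(h, [(a, id)])\<close> is an arrow of \<open>\<up>P\<close> over \<open>h : \<pi> a \<rightarrow> x\<close> from \<open>\<phi>\<^sub>P a\<close> to \<open>(x, [(a, h)])\<close>.
  Hence a morphism \<open>\<psi> : \<up>P \<rightarrow> D\<close> with \<open>\<psi> \<circ> \<phi>\<^sub>P = \<phi>\<close> must send \<open>(x, [(a, h)])\<close> to the transport of
  \<open>\<phi> a\<close> along \<open>h\<close>, and this value is constant on components because an arrow \<open>u : a \<rightarrow> b\<close> of \<open>P\<close>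
  is sent by \<open>\<phi>\<close> to the lift of \<open>\<pi> u\<close> at \<open>\<phi> a\<close>.
\<close>

section \<open>Functors and morphisms over a base\<close>

lemma is_functorD:
  assumes "is_functor C D F"
  shows "a \<in> Obj C \<Longrightarrow> omap F a \<in> Obj D"
    and "f \<in> Arr C \<Longrightarrow> amap F f \<in> Arr D"
    and "f \<in> Arr C \<Longrightarrow> Dom D (amap F f) = omap F (Dom C f)"
    and "f \<in> Arr C \<Longrightarrow> Cod D (amap F f) = omap F (Cod C f)"
    and "a \<in> Obj C \<Longrightarrow> amap F (Ident C a) = Ident D (omap F a)"
    and "\<lbrakk>f \<in> Arr C; g \<in> Arr C; Dom C g = Cod C f\<rbrakk>
      \<Longrightarrow> amap F (g \<cdot>\<^bsub>C\<^esub> f) = amap F g \<cdot>\<^bsub>D\<^esub> amap F f"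
  using assms by (auto simp: is_functor_def)

lemma fctr_eqI:
  fixes F G :: "('o, 'a, 'p, 'b) fctr"
  assumes "omap F \<in> extensional A" "omap G \<in> extensional A"
    and "amap F \<in> extensional B" "amap G \<in> extensional B"
    and "\<And>a. a \<in> A \<Longrightarrow> omap F a = omap G a" and "\<And>f. f \<in> B \<Longrightarrow> amap F f = amap G f"
  shows "F = G"
proof -
  have "omap F = omap G" "amap F = amap G"
    using assms by (auto intro: extensionalityI)
  then show ?thesis by simp
qed

lemma is_functor_extensional:
  assumes "is_functor C D F"
  shows "omap F \<in> extensional (Obj C)" "amap F \<in> extensional (Arr C)"
  using assms by (auto simp: is_functor_def PiE_def)

text \<open>Both sides are extensional on \<open>C\<close>, so the HOL equality reduces to pointwise
  equations. This is the form in which the triangles over \<open>X\<close> and the equation with the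
  unit are used below.\<close>

lemma comp_functor_eq_iff:
  assumes "is_functor C D H"
  shows "comp_functor C G F = H \<longleftrightarrow>
    (\<forall>a\<in>Obj C. omap G (omap F a) = omap H a) \<and> (\<forall>f\<in>Arr C. amap G (amap F f) = amap H f)"
    (is "?L \<longleftrightarrow> ?R")
proof
  assume ?L
  then show ?R by (auto simp: comp_functor_def compose_def)
next
  assume ?R
  then show ?L
    by (intro fctr_eqI[where A = "Obj C" and B = "Arr C"] is_functor_extensional[OF assms])
      (auto simp: comp_functor_def compose_def)
qed

section \<open>Connected components\<close>

text \<open>The reflexive closure ranges over the whole type, so the carrier is \<open>UNIV\<close>
  and not \<open>Obj C\<close>. Equations between components can then be handled for arbitrary
  points.\<close>

lemma equiv_connected_rel: "equiv UNIV (connected_rel C)"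
proof -
  define r where "r = {(Dom C f, Cod C f) | f. f \<in> Arr C}"
  have "connected_rel C = (r \<union> r\<inverse>)\<^sup>*" by (simp add: connected_rel_def Let_def r_def)
  moreover have "sym ((r \<union> r\<inverse>)\<^sup>*)" by (rule sym_rtrancl[OF sym_Un_converse])
  ultimately show ?thesis by (simp add: equiv_def refl_rtrancl trans_rtrancl)
qed

lemma component_eq_iff: "component C a = component C b \<longleftrightarrow> (a, b) \<in> connected_rel C"
  by (simp add: component_def eq_equiv_class_iff[OF equiv_connected_rel])

lemma mem_component_iff: "b \<in> component C a \<longleftrightarrow> component C a = component C b"
  by (simp add: component_eq_iff) (simp add: component_def)

lemma component_Dom_Cod: "f \<in> Arr C \<Longrightarrow> component C (Dom C f) = component C (Cod C f)"
  unfolding component_eq_iff connected_rel_def Let_def by (rule r_into_rtrancl) auto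

text \<open>Equal components mean a zigzag of arrows, and \<open>g\<close> keeps its value along
  each step. Every well-definedness argument about components below goes through this.\<close>

lemma component_invariant:
  assumes "component C a = component C b"
    and "\<And>f. f \<in> Arr C \<Longrightarrow> g (Dom C f) = g (Cod C f)"
  shows "g a = g b"
proof -
  have "(a, b) \<in> ({(Dom C f, Cod C f) | f. f \<in> Arr C} \<union> {(Dom C f, Cod C f) | f. f \<in> Arr C}\<inverse>)\<^sup>*"
    using assms(1) by (simp add: component_eq_iff connected_rel_def Let_def)
  then show ?thesis
    by (induction rule: rtrancl_induct) (auto simp: assms(2))
qed

lemma components_eq: "components C = component C ` Obj C"
  by (auto simp: components_def component_def quotient_def)

text \<open>Two mutually inverse object maps that send the endpoints of each arrow to connected
  objects induce mutually inverse maps of components. The map \<open>\<theta>\<close> is also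
  described on representatives, so that the bijection is an explicit one.\<close>

lemma components_bij_betw:
  assumes m: "\<And>a. a \<in> Obj C \<Longrightarrow> m a \<in> Obj D" and n: "\<And>b. b \<in> Obj D \<Longrightarrow> n b \<in> Obj C"
    and nm: "\<And>a. a \<in> Obj C \<Longrightarrow> n (m a) = a" and mn: "\<And>b. b \<in> Obj D \<Longrightarrow> m (n b) = b"
    and m_arr: "\<And>f. f \<in> Arr C \<Longrightarrow> component D (m (Dom C f)) = component D (m (Cod C f))"
    and n_arr: "\<And>f. f \<in> Arr D \<Longrightarrow> component C (n (Dom D f)) = component C (n (Cod D f))"
  obtains \<theta> where "bij_betw \<theta> (components C) (components D)"
    and "\<And>a. a \<in> Obj C \<Longrightarrow> \<theta> (component C a) = component D (m a)"
proof
  \<comment> \<open>Any point with component \<open>c\<close> serves as representative;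
    \<open>component_invariant\<close> makes the value independent of the choice.\<close>
  define \<theta> where "\<theta> c = component D (m (SOME a. component C a = c))" for c
  show \<theta>: "\<theta> (component C a) = component D (m a)" for a
  proof -
    have "component C (SOME a'. component C a' = component C a) = component C a"
      by (rule someI) simp
    from component_invariant[OF this, of "\<lambda>a. component D (m a)"] m_arr
    show ?thesis by (simp add: \<theta>_def)
  qed
  show "bij_betw \<theta> (components C) (components D)"
    unfolding bij_betw_def components_eq
  proof
    show "inj_on \<theta> (component C ` Obj C)"
    proof (rule inj_onI, elim imageE, hypsubst)
      fix a b assume "a \<in> Obj C" "b \<in> Obj C" "\<theta> (component C a) = \<theta> (component C b)"
      \<comment> \<open>Injectivity: \<open>n\<close> carries the equality of components of
        \<open>D\<close> back to \<open>C\<close>, where \<open>n (m a) = a\<close>.\<close>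
      then show "component C a = component C b"
        using component_invariant[of D "m a" "m b" "\<lambda>a. component C (n a)"] n_arr
        by (simp add: \<theta> nm)
    qed
    have "m ` Obj C = Obj D"
      using m n mn by force
    then show "\<theta> ` component C ` Obj C = component D ` Obj D"
      by (simp add: image_image \<theta> flip: \<open>m ` Obj C = Obj D\<close>)
  qed
qed

section \<open>Lifts in a discrete opfibration\<close>

locale over_category = X: category X + P: category P
  for X :: "('xo, 'xa) cat" and P :: "('o, 'a, 'xo, 'xa) over" +
  assumes proj_functor: "is_functor P X (proj P)"
begin

lemmas proj_simps = is_functorD[OF proj_functor]

end

lemma over_category_iff: "over_category X P \<longleftrightarrow> category X \<and> category_over X P"
  by (auto simp: over_category_def over_category_axioms_def category_over_def)

locale discrete_opfibration_over = over_category X D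
  for X :: "('xo, 'xa) cat" and D :: "('o, 'a, 'xo, 'xa) over" +
  assumes lift_unique_exists: "\<lbrakk>a \<in> Obj D; f \<in> Arr X; Dom X f = omap (proj D) a\<rbrakk>
    \<Longrightarrow> \<exists>!u. u \<in> Arr D \<and> Dom D u = a \<and> amap (proj D) u = f"
begin

definition lift :: "'xa \<Rightarrow> 'o \<Rightarrow> 'a" where
  "lift f a = (THE u. u \<in> Arr D \<and> Dom D u = a \<and> amap (proj D) u = f)"

lemma transport_eq: "transport D f a = Cod D (lift f a)"
  by (simp add: transport_def lift_def)

lemma lift:
  assumes "a \<in> Obj D" "f \<in> Arr X" "Dom X f = omap (proj D) a"
  shows "lift f a \<in> Arr D" "Dom D (lift f a) = a" "amap (proj D) (lift f a) = f"
  using theI'[OF lift_unique_exists[OF assms]] by (auto simp: lift_def)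

text \<open>Here \<open>a\<close> and \<open>f\<close> are the domain and the projection of
  \<open>u\<close>, so the side conditions for the existence of a unique lift follow from
  functoriality of the projection. Equations between lifts are proved below by exhibiting an arrow
  with the right domain and projection.\<close>

lemma lift_eqI:
  assumes "u \<in> Arr D" "Dom D u = a" "amap (proj D) u = f"
  shows "lift f a = u"
proof -
  have "\<exists>!u. u \<in> Arr D \<and> Dom D u = a \<and> amap (proj D) u = f"
    using proj_simps(2,3)[OF assms(1)] P.Dom_closed[OF assms(1)] unfolding assms(2,3)
    by (intro lift_unique_exists)
  from the1_equality[OF this] show ?thesis
    using assms by (simp add: lift_def)
qed

lemma transport:
  assumes "a \<in> Obj D" "f \<in> Arr X" "Dom X f = omap (proj D) a"
  shows "transport D f a \<in> Obj D" "omap (proj D) (transport D f a) = Cod X f"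
  using lift[OF assms] P.Cod_closed proj_simps(4)[of "lift f a"] by (auto simp: transport_eq)

lemma lift_Ident: "a \<in> Obj D \<Longrightarrow> lift (Ident X (omap (proj D) a)) a = Ident D a"
  by (intro lift_eqI) (auto simp: P.Ident_closed P.Dom_Ident proj_simps)

lemma transport_Ident: "a \<in> Obj D \<Longrightarrow> transport D (Ident X (omap (proj D) a)) a = a"
  by (simp add: transport_eq lift_Ident P.Cod_Ident)

text \<open>The composite of the two successive lifts starts at \<open>a\<close> and lies over the
  composite of \<open>g\<close> and \<open>f\<close>, so it is the unique such arrow. Taking
  codomains gives the law for \<open>transport\<close>.\<close>

lemma lift_Comp:
  assumes "a \<in> Obj D" "f \<in> Arr X" "Dom X f = omap (proj D) a" "g \<in> Arr X" "Dom X g = Cod X f"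
  shows "lift (g \<cdot>\<^bsub>X\<^esub> f) a = lift g (transport D f a) \<cdot>\<^bsub>D\<^esub> lift f a"
    and "transport D (g \<cdot>\<^bsub>X\<^esub> f) a = transport D g (transport D f a)"
proof -
  note f = lift[OF assms(1-3)] and t = transport[OF assms(1-3)]
  have g: "lift g (transport D f a) \<in> Arr D" "Dom D (lift g (transport D f a)) = Cod D (lift f a)"
    "amap (proj D) (lift g (transport D f a)) = g"
    using lift[of "transport D f a" g] t assms by (simp_all add: transport_eq)
  show *: "lift (g \<cdot>\<^bsub>X\<^esub> f) a = lift g (transport D f a) \<cdot>\<^bsub>D\<^esub> lift f a"
    by (rule lift_eqI) (simp_all add: f g P.Comp_closed P.Dom_Comp proj_simps)
  show "transport D (g \<cdot>\<^bsub>X\<^esub> f) a = transport D g (transport D f a)"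
    by (subst transport_eq, subst *) (simp add: f g P.Cod_Comp transport_eq[of g])
qed

end

lemma discrete_opfibration_iff:
  "category X \<Longrightarrow> discrete_opfibration X D \<longleftrightarrow> discrete_opfibration_over X D"
  unfolding discrete_opfibration_def discrete_opfibration_over_def
    discrete_opfibration_over_axioms_def over_category_iff
  by (simp add: Ball_def)

section \<open>The category of elements\<close>

lemma elements_simps:
  "Obj (elements X F A) = (SIGMA x:Obj X. F x)"
  "Arr (elements X F A) = (SIGMA f:Arr X. F (Dom X f))"
  "Dom (elements X F A) (f, c) = (Dom X f, c)"
  "Cod (elements X F A) (f, c) = (Cod X f, A f c)"
  "Ident (elements X F A) (x, c) = (Ident X x, c)"
  "(g, d) \<cdot>\<^bsub>elements X F A\<^esub> (f, c) = (g \<cdot>\<^bsub>X\<^esub> f, c)"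
  "\<lbrakk>x \<in> Obj X; c \<in> F x\<rbrakk> \<Longrightarrow> omap (proj (elements X F A)) (x, c) = x"
  "\<lbrakk>f \<in> Arr X; c \<in> F (Dom X f)\<rbrakk> \<Longrightarrow> amap (proj (elements X F A)) (f, c) = f"
  by (auto simp: elements_def Let_def)

lemma elements_proj_extensional:
  "omap (proj (elements X F A)) \<in> extensional (Obj (elements X F A))"
  "amap (proj (elements X F A)) \<in> extensional (Arr (elements X F A))"
  by (auto simp: elements_def Let_def)

text \<open>The Grothendieck construction of a functor from \<open>X\<close> to sets: the lift of
  \<open>f\<close> at \<open>(Dom X f, c)\<close> is \<open>(f, c)\<close>. The laws
  \<open>A_Ident\<close> and \<open>A_Comp\<close> give identities and composites the right
  codomains.\<close>

lemma discrete_opfibration_elements: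
  fixes X :: "('xo, 'xa) cat"
  assumes "category X"
    and A: "\<And>f c. \<lbrakk>f \<in> Arr X; c \<in> F (Dom X f)\<rbrakk> \<Longrightarrow> A f c \<in> F (Cod X f)"
    and A_Ident: "\<And>x c. \<lbrakk>x \<in> Obj X; c \<in> F x\<rbrakk> \<Longrightarrow> A (Ident X x) c = c"
    and A_Comp: "\<And>f g c. \<lbrakk>f \<in> Arr X; g \<in> Arr X; Dom X g = Cod X f; c \<in> F (Dom X f)\<rbrakk>
      \<Longrightarrow> A (g \<cdot>\<^bsub>X\<^esub> f) c = A g (A f c)"
  shows "discrete_opfibration X (elements X F A)"
proof -
  interpret X: category X by fact
  have "category (elements X F A)"
    by unfold_locales
      (auto simp: elements_simps A A_Ident A_Comp X.Dom_closed X.Cod_closed X.Ident_closed X.Dom_Ident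
        X.Cod_Ident X.Comp_closed X.Dom_Comp X.Cod_Comp X.Comp_Ident X.Ident_Comp X.Comp_assoc)
  moreover have "is_functor (elements X F A) X (proj (elements X F A))"
    unfolding is_functor_def PiE_def using elements_proj_extensional[of X F A]
    by (auto simp: elements_simps A X.Dom_closed X.Cod_closed X.Ident_closed X.Dom_Ident
        X.Comp_closed X.Dom_Comp)
  ultimately show ?thesis
    unfolding discrete_opfibration_def category_over_def
    by (auto simp: elements_simps)
qed

section \<open>Components of comma categories\<close>

lemma comma_simps:
  "(a, h) \<in> Obj (comma X P x) \<longleftrightarrow>
     a \<in> Obj P \<and> h \<in> Arr X \<and> Dom X h = omap (proj P) a \<and> Cod X h = x"
  "((a, h), u, (b, k)) \<in> Arr (comma X P x) \<longleftrightarrow>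
     (a, h) \<in> Obj (comma X P x) \<and> (b, k) \<in> Obj (comma X P x) \<and>
     u \<in> Arr P \<and> Dom P u = a \<and> Cod P u = b \<and> k \<cdot>\<^bsub>X\<^esub> amap (proj P) u = h"
  "Dom (comma X P x) (s, u, t) = s"
  "Cod (comma X P x) (s, u, t) = t"
  "omap (proj (comma X P x)) (a, h) =
     (if (a, h) \<in> Obj (comma X P x) then omap (proj P) a else undefined)"
  "amap (proj (comma X P x)) (s, u, t) =
     (if (s, u, t) \<in> Arr (comma X P x) then amap (proj P) u else undefined)"
  by (auto simp: comma_def Let_def)

context over_category
begin

text \<open>The arrow \<open>u\<close> of \<open>P\<close> is itself an arrow of the comma category
  between these two objects.\<close>

lemma comma_component_step:
  assumes "u \<in> Arr P" "k \<in> Arr X" "Dom X k = omap (proj P) (Cod P u)" "Cod X k = x"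
  shows "component (comma X P x) (Dom P u, k \<cdot>\<^bsub>X\<^esub> amap (proj P) u)
    = component (comma X P x) (Cod P u, k)"
proof -
  have "((Dom P u, k \<cdot>\<^bsub>X\<^esub> amap (proj P) u), u, (Cod P u, k)) \<in> Arr (comma X P x)"
    using assms by (simp add: comma_simps proj_simps P.Dom_closed P.Cod_closed
        X.Comp_closed X.Dom_Comp X.Cod_Comp)
  from component_Dom_Cod[OF this] show ?thesis by (simp add: comma_simps)
qed

text \<open>Every arrow of the comma category arises from some \<open>u\<close> and \<open>k\<close>
  as in the second premise, so invariance is tested on these alone. It serves both the action on
  components and the extension of a morphism.\<close>

lemma comma_component_invariant:
  assumes "component (comma X P x) (a, h) = component (comma X P x) (b, k)"
    and "\<And>u k. \<lbrakk>u \<in> Arr P; k \<in> Arr X; Dom X k = omap (proj P) (Cod P u); Cod X k = x\<rbrakk>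
      \<Longrightarrow> g (Dom P u) (k \<cdot>\<^bsub>X\<^esub> amap (proj P) u) = g (Cod P u) k"
  shows "g a h = g b k"
  using component_invariant[OF assms(1), where g = "case_prod g"] assms(2)
  by (force simp: comma_simps)

text \<open>Discharges the definite description in \<open>component_action\<close>. Composing with
  \<open>f\<close> turns an arrow \<open>u\<close> over \<open>Dom X f\<close> into the same
  \<open>u\<close> over \<open>Cod X f\<close>, by associativity in \<open>X\<close>, so connected
  representatives stay connected.\<close>

lemma component_action_component:
  assumes "(a, h) \<in> Obj (comma X P (Dom X f))" and "f \<in> Arr X"
  shows "component_action X P f (component (comma X P (Dom X f)) (a, h))
    = component (comma X P (Cod X f)) (a, f \<cdot>\<^bsub>X\<^esub> h)"
  unfolding component_action_def
proof (rule the_equality)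
  let ?c = "component (comma X P (Dom X f)) (a, h)"
  show "\<exists>(b, k)\<in>?c. component (comma X P (Cod X f)) (a, f \<cdot>\<^bsub>X\<^esub> h)
      = component (comma X P (Cod X f)) (b, f \<cdot>\<^bsub>X\<^esub> k)"
    by (rule bexI[of _ "(a, h)"]) (auto simp: mem_component_iff)
  fix d assume "\<exists>(b, k)\<in>?c. d = component (comma X P (Cod X f)) (b, f \<cdot>\<^bsub>X\<^esub> k)"
  then obtain b k where bk: "?c = component (comma X P (Dom X f)) (b, k)"
    and d: "d = component (comma X P (Cod X f)) (b, f \<cdot>\<^bsub>X\<^esub> k)"
    by (auto simp: mem_component_iff)
  have "component (comma X P (Cod X f)) (a, f \<cdot>\<^bsub>X\<^esub> h) = component (comma X P (Cod X f)) (b, f \<cdot>\<^bsub>X\<^esub> k)"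
    using bk
  proof (rule comma_component_invariant[where g = "\<lambda>a h. component (comma X P (Cod X f)) (a, f \<cdot>\<^bsub>X\<^esub> h)"])
    fix u k assume *: "u \<in> Arr P" "k \<in> Arr X" "Dom X k = omap (proj P) (Cod P u)" "Cod X k = Dom X f"
    show "component (comma X P (Cod X f)) (Dom P u, f \<cdot>\<^bsub>X\<^esub> (k \<cdot>\<^bsub>X\<^esub> amap (proj P) u))
        = component (comma X P (Cod X f)) (Cod P u, f \<cdot>\<^bsub>X\<^esub> k)"
      using comma_component_step[of u "f \<cdot>\<^bsub>X\<^esub> k" "Cod X f"] * assms(2)
      by (simp add: proj_simps X.Comp_assoc X.Comp_closed X.Dom_Comp X.Cod_Comp)
  qed
  then show "d = component (comma X P (Cod X f)) (a, f \<cdot>\<^bsub>X\<^esub> h)" by (simp add: d)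
qed

lemma comma_componentsE:
  assumes "c \<in> components (comma X P x)"
  obtains a h where "c = component (comma X P x) (a, h)" "a \<in> Obj P" "h \<in> Arr X"
    "Dom X h = omap (proj P) a" "Cod X h = x"
  using assms by (auto simp: components_eq comma_simps)

lemma comma_componentsI:
  assumes "a \<in> Obj P" "h \<in> Arr X" "Dom X h = omap (proj P) a" "Cod X h = x"
  shows "component (comma X P x) (a, h) \<in> components (comma X P x)"
  using assms by (auto simp: components_eq comma_simps)

lemma component_action_in:
  assumes "f \<in> Arr X" "c \<in> components (comma X P (Dom X f))"
  shows "component_action X P f c \<in> components (comma X P (Cod X f))"
  using assms(2,1)
  by (elim comma_componentsE)
    (simp add: component_action_component comma_componentsI comma_simps
      X.Comp_closed X.Dom_Comp X.Cod_Comp)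

section \<open>The discrete opfibration of components and its action\<close>

lemma discrete_opfibration_up: "discrete_opfibration X (up X P)"
  unfolding up_def
proof (rule discrete_opfibration_elements)
  show "category X" by unfold_locales
next
  fix f c assume "f \<in> Arr X" "c \<in> components (comma X P (Dom X f))"
  then show "component_action X P f c \<in> components (comma X P (Cod X f))"
    by (rule component_action_in)
next
  fix x c assume "x \<in> Obj X" and "c \<in> components (comma X P x)"
  then show "component_action X P (Ident X x) c = c"
    using component_action_component[where f = "Ident X x"]
    by (elim comma_componentsE)
      (auto simp: comma_simps X.Ident_closed X.Dom_Ident X.Cod_Ident X.Ident_Comp)
next
  fix f g c assume "f \<in> Arr X" "g \<in> Arr X" "Dom X g = Cod X f" "c \<in> components (comma X P (Dom X f))"
  then show "component_action X P (g \<cdot>\<^bsub>X\<^esub> f) c = component_action X P g (component_action X P f c)"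
    \<comment> \<open>These instances speak of the domains of the composite and of \<open>g\<close>;
      they are given explicitly so that simplification can turn these domains into
      \<open>Dom X f\<close> and \<open>Cod X f\<close>.\<close>
    using component_action_component[where f = "g \<cdot>\<^bsub>X\<^esub> f"] component_action_component[where f = g]
    by (elim comma_componentsE)
      (simp add: component_action_component comma_simps X.Comp_closed X.Dom_Comp X.Cod_Comp X.Comp_assoc)
qed

lemma is_functor_up_proj: "is_functor (up X P) X (proj (up X P))"
  using discrete_opfibration_up by (simp add: discrete_opfibration_def category_over_def)

lemma up_simps:
  "(x, c) \<in> Obj (up X P) \<longleftrightarrow> x \<in> Obj X \<and> c \<in> components (comma X P x)"
  "(f, c) \<in> Arr (up X P) \<longleftrightarrow> f \<in> Arr X \<and> c \<in> components (comma X P (Dom X f))"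
  "Dom (up X P) (f, c) = (Dom X f, c)"
  "Cod (up X P) (f, c) = (Cod X f, component_action X P f c)"
  "Ident (up X P) (x, c) = (Ident X x, c)"
  "(g, d) \<cdot>\<^bsub>up X P\<^esub> (f, c) = (g \<cdot>\<^bsub>X\<^esub> f, c)"
  "\<lbrakk>x \<in> Obj X; c \<in> components (comma X P x)\<rbrakk> \<Longrightarrow> omap (proj (up X P)) (x, c) = x"
  "\<lbrakk>f \<in> Arr X; c \<in> components (comma X P (Dom X f))\<rbrakk> \<Longrightarrow> amap (proj (up X P)) (f, c) = f"
  by (simp_all add: up_def elements_simps)

lemma fiber_up: "x \<in> Obj X \<Longrightarrow> fiber (up X P) x = {x} \<times> components (comma X P x)"
  by (auto simp: fiber_def up_simps)

text \<open>The lift of \<open>f\<close> at \<open>(Dom X f, c)\<close> is the pair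
  \<open>(f, c)\<close>, and its codomain is given by \<open>component_action\<close>.\<close>

lemma transport_up:
  assumes "f \<in> Arr X" "(a, h) \<in> Obj (comma X P (Dom X f))"
  shows "transport (up X P) f (Dom X f, component (comma X P (Dom X f)) (a, h))
    = (Cod X f, component (comma X P (Cod X f)) (a, f \<cdot>\<^bsub>X\<^esub> h))"
proof -
  interpret U: discrete_opfibration_over X "up X P"
    using discrete_opfibration_up discrete_opfibration_iff X.category_axioms by blast
  let ?c = "component (comma X P (Dom X f)) (a, h)"
  have c: "?c \<in> components (comma X P (Dom X f))"
    using assms by (auto simp: components_eq)
  have "U.lift f (Dom X f, ?c) = (f, ?c)"
    by (rule U.lift_eqI) (simp_all add: up_simps assms c)
  then show ?thesis
    by (simp add: U.transport_eq up_simps component_action_component assms)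
qed

section \<open>The unit morphism\<close>

lemma unit_component:
  "a \<in> Obj P \<Longrightarrow> component (comma X P (omap (proj P) a)) (a, Ident X (omap (proj P) a))
    \<in> components (comma X P (omap (proj P) a))"
  by (simp add: comma_componentsI proj_simps X.Ident_closed X.Dom_Ident X.Cod_Ident)

text \<open>Gives the codomain of the arrow of \<open>up X P\<close> that lifts \<open>h\<close> at
  the image of \<open>a\<close> under the unit. It is used with \<open>h\<close> the projection of
  an arrow for functoriality of the unit, and with general \<open>h\<close> for uniqueness of the
  extension.\<close>

lemma component_action_unit:
  assumes "a \<in> Obj P" "h \<in> Arr X" "Dom X h = omap (proj P) a"
  shows "component_action X P h (component (comma X P (omap (proj P) a)) (a, Ident X (omap (proj P) a)))
    = component (comma X P (Cod X h)) (a, h)"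
  using component_action_component[of a "Ident X (omap (proj P) a)" h] assms X.Comp_Ident[of h]
  by (simp add: comma_simps proj_simps X.Ident_closed X.Dom_Ident X.Cod_Ident)

lemma omap_unit:
  "a \<in> Obj P \<Longrightarrow> omap (unit_morphism X P) a
    = (omap (proj P) a, component (comma X P (omap (proj P) a)) (a, Ident X (omap (proj P) a)))"
  by (simp add: unit_morphism_def unit_obj_def Let_def)

lemma amap_unit:
  "u \<in> Arr P \<Longrightarrow> amap (unit_morphism X P) u
    = (amap (proj P) u, component (comma X P (omap (proj P) (Dom P u)))
        (Dom P u, Ident X (omap (proj P) (Dom P u))))"
  by (simp add: unit_morphism_def unit_obj_def Let_def)

text \<open>In the comma category over the projection of \<open>Cod P u\<close>, the arrow
  \<open>u\<close> joins these two objects: this is \<open>comma_component_step\<close> with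
  \<open>k\<close> an identity. Together with \<open>component_action_unit\<close> it shows that the
  unit respects codomains.\<close>

lemma component_arrow:
  assumes "u \<in> Arr P"
  shows "component (comma X P (omap (proj P) (Cod P u))) (Dom P u, amap (proj P) u)
    = component (comma X P (omap (proj P) (Cod P u))) (Cod P u, Ident X (omap (proj P) (Cod P u)))"
  using comma_component_step[of u "Ident X (omap (proj P) (Cod P u))"] assms X.Ident_Comp[of "amap (proj P) u"]
  by (simp add: proj_simps P.Cod_closed X.Ident_closed X.Dom_Ident X.Cod_Ident)

lemma over_morphism_unit: "over_morphism P (up X P) (unit_morphism X P)"
proof -
  have "is_functor P (up X P) (unit_morphism X P)"
    unfolding is_functor_def PiE_def
  proof (intro conjI IntI Pi_I ballI impI)
    show "omap (unit_morphism X P) \<in> extensional (Obj P)" "amap (unit_morphism X P) \<in> extensional (Arr P)"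
      by (simp_all add: unit_morphism_def)
  qed (simp_all add: omap_unit amap_unit up_simps unit_component proj_simps component_action_unit
      component_arrow P.Dom_closed P.Cod_closed P.Ident_closed P.Dom_Ident P.Comp_closed P.Dom_Comp)
  then show ?thesis
    unfolding over_morphism_def comp_functor_eq_iff[OF proj_functor]
    by (simp add: omap_unit amap_unit up_simps unit_component proj_simps P.Dom_closed)
qed

end

section \<open>The universal property\<close>

locale morphism_to_discrete_opfibration = over_category X P + D: discrete_opfibration_over X D
  for X :: "('xo, 'xa) cat" and P :: "('o, 'a, 'xo, 'xa) over" and D :: "('p, 'b, 'xo, 'xa) over" +
  fixes \<phi> :: "('o, 'a, 'p, 'b) fctr"
  assumes over_morphism: "over_morphism P D \<phi>"
begin

lemma phi_functor: "is_functor P D \<phi>"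
  using over_morphism by (simp add: over_morphism_def)

lemmas phi_simps = is_functorD[OF phi_functor]

lemma proj_phi:
  "a \<in> Obj P \<Longrightarrow> omap (proj D) (omap \<phi> a) = omap (proj P) a"
  "u \<in> Arr P \<Longrightarrow> amap (proj D) (amap \<phi> u) = amap (proj P) u"
  using over_morphism by (simp_all add: over_morphism_def comp_functor_eq_iff[OF proj_functor])

text \<open>The arrow part of \<open>\<phi>\<close> is determined by its object part:
  \<open>amap \<phi> u\<close> starts at the image of \<open>Dom P u\<close> and lies over the
  projection of \<open>u\<close>.\<close>

lemma lift_phi: "u \<in> Arr P \<Longrightarrow> D.lift (amap (proj P) u) (omap \<phi> (Dom P u)) = amap \<phi> u"
  by (rule D.lift_eqI) (simp_all add: phi_simps proj_phi)

text \<open>Transport along a composite splits into two steps, and the first of them, along the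
  projection of \<open>u\<close>, takes the image of \<open>Dom P u\<close> to the image of
  \<open>Cod P u\<close>.\<close>

lemma transport_phi_invariant:
  assumes "component (comma X P x) (a, h) = component (comma X P x) (b, k)"
  shows "transport D h (omap \<phi> a) = transport D k (omap \<phi> b)"
  using assms
proof (rule comma_component_invariant[where g = "\<lambda>a h. transport D h (omap \<phi> a)"])
  fix u k assume *: "u \<in> Arr P" "k \<in> Arr X" "Dom X k = omap (proj P) (Cod P u)" "Cod X k = x"
  have "transport D (amap (proj P) u) (omap \<phi> (Dom P u)) = omap \<phi> (Cod P u)"
    by (simp add: D.transport_eq lift_phi phi_simps *)
  then show "transport D (k \<cdot>\<^bsub>X\<^esub> amap (proj P) u) (omap \<phi> (Dom P u)) = transport D k (omap \<phi> (Cod P u))"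
    using * by (simp add: D.lift_Comp(2) phi_simps proj_phi proj_simps P.Dom_closed)
qed

section \<open>Construction of the extension along the unit\<close>

definition extension_obj :: "('o \<times> 'xa) set \<Rightarrow> 'p" where
  "extension_obj c = (let (a, h) = SOME s. s \<in> c in transport D h (omap \<phi> a))"

text \<open>A morphism over \<open>X\<close> has no choice on arrows: \<open>(f, c)\<close> must go
  to an arrow over \<open>f\<close> that starts at the image of its domain, hence to the
  lift.\<close>

definition extension :: "('xo \<times> ('o \<times> 'xa) set, 'xa \<times> ('o \<times> 'xa) set, 'p, 'b) fctr" where
  "extension = \<lparr>omap = (\<lambda>(x, c)\<in>Obj (up X P). extension_obj c),
     amap = (\<lambda>(f, c)\<in>Arr (up X P). D.lift f (extension_obj c))\<rparr>"

text \<open>The chosen representative lies in the same component as \<open>(a, h)\<close>, so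
  \<open>transport_phi_invariant\<close> allows it to be replaced by \<open>(a, h)\<close>.\<close>

lemma extension_obj: "extension_obj (component (comma X P x) (a, h)) = transport D h (omap \<phi> a)"
proof -
  let ?c = "component (comma X P x) (a, h)"
  obtain b k where bk: "(SOME s. s \<in> ?c) = (b, k)" by fastforce
  moreover have "(SOME s. s \<in> ?c) \<in> ?c"
    by (rule someI[of _ "(a, h)"]) (simp add: mem_component_iff)
  ultimately have "?c = component (comma X P x) (b, k)"
    by (simp add: mem_component_iff)
  from transport_phi_invariant[OF this] show ?thesis
    by (simp add: extension_obj_def bk)
qed

lemma extension_obj_in:
  assumes "c \<in> components (comma X P x)"
  shows "extension_obj c \<in> Obj D" "omap (proj D) (extension_obj c) = x"
proof -
  obtain a h where "c = component (comma X P x) (a, h)" "a \<in> Obj P" "h \<in> Arr X"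
    "Dom X h = omap (proj P) a" "Cod X h = x"
    using assms by (rule comma_componentsE)
  then show "extension_obj c \<in> Obj D" "omap (proj D) (extension_obj c) = x"
    by (simp_all add: extension_obj D.transport phi_simps proj_phi)
qed

text \<open>Naturality in the base: for a representative \<open>(a, h)\<close>, both sides transport
  the image of \<open>a\<close> along \<open>h\<close> and then along \<open>f\<close>. This is what
  makes \<open>extension\<close> respect codomains.\<close>

lemma extension_obj_action:
  assumes "f \<in> Arr X" "c \<in> components (comma X P (Dom X f))"
  shows "extension_obj (component_action X P f c) = transport D f (extension_obj c)"
proof -
  obtain a h where "c = component (comma X P (Dom X f)) (a, h)" "a \<in> Obj P" "h \<in> Arr X"
    "Dom X h = omap (proj P) a" "Cod X h = Dom X f"
    using assms(2) by (rule comma_componentsE)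
  then show ?thesis
    using assms(1) by (simp add: extension_obj component_action_component comma_simps D.lift_Comp(2)
        phi_simps proj_phi)
qed

lemma extension_simps:
  "\<lbrakk>x \<in> Obj X; c \<in> components (comma X P x)\<rbrakk> \<Longrightarrow> omap extension (x, c) = extension_obj c"
  "\<lbrakk>f \<in> Arr X; c \<in> components (comma X P (Dom X f))\<rbrakk> \<Longrightarrow> amap extension (f, c) = D.lift f (extension_obj c)"
  by (simp_all add: extension_def up_simps)

text \<open>Domains are right by the choice of lifts and codomains by
  \<open>extension_obj_action\<close>. Identities and composites are preserved because lifts are
  unique.\<close>

lemma is_functor_extension: "is_functor (up X P) D extension"
  unfolding is_functor_def PiE_def
proof (intro conjI IntI Pi_I ballI impI)
  show "omap extension \<in> extensional (Obj (up X P))" "amap extension \<in> extensional (Arr (up X P))"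
    by (simp_all add: extension_def)
next
  fix s assume s: "s \<in> Obj (up X P)"
  obtain x c where [simp]: "s = (x, c)" by fastforce
  have xc: "x \<in> Obj X" "c \<in> components (comma X P x)"
    using s by (simp_all add: up_simps)
  show "omap extension s \<in> Obj D"
    using xc by (simp add: extension_simps extension_obj_in)
  show "amap extension (Ident (up X P) s) = Ident D (omap extension s)"
    using xc D.lift_Ident[of "extension_obj c"] extension_obj_in[OF xc(2)]
    by (simp add: up_simps extension_simps X.Ident_closed X.Dom_Ident)
next
  fix s assume s: "s \<in> Arr (up X P)"
  obtain f c where [simp]: "s = (f, c)" by fastforce
  have fc: "f \<in> Arr X" "c \<in> components (comma X P (Dom X f))"
    using s by (simp_all add: up_simps)
  note c = extension_obj_in[OF fc(2)]
  show "amap extension s \<in> Arr D"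
    and "Dom D (amap extension s) = omap extension (Dom (up X P) s)"
    using fc c by (simp_all add: up_simps extension_simps D.lift X.Dom_closed)
  show "Cod D (amap extension s) = omap extension (Cod (up X P) s)"
    using fc component_action_in[OF fc]
    by (simp add: up_simps extension_simps extension_obj_action D.transport_eq X.Cod_closed)
  fix t assume t: "t \<in> Arr (up X P)" "Dom (up X P) t = Cod (up X P) s"
  obtain g d where [simp]: "t = (g, d)" by fastforce
  have g: "g \<in> Arr X" "Dom X g = Cod X f" "d = component_action X P f c"
    using t by (simp_all add: up_simps)
  show "amap extension (t \<cdot>\<^bsub>up X P\<^esub> s) = amap extension t \<cdot>\<^bsub>D\<^esub> amap extension s"
    using fc g c component_action_in[OF fc]
    by (simp add: up_simps extension_simps X.Comp_closed X.Dom_Comp extension_obj_action D.lift_Comp(1))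
qed

lemma over_morphism_extension: "over_morphism (up X P) D extension"
  unfolding over_morphism_def comp_functor_eq_iff[OF is_functor_up_proj]
  using is_functor_extension
  by (auto simp: up_simps extension_simps extension_obj_in D.lift X.Dom_closed)

text \<open>On objects, transport along an identity changes nothing; on arrows, the claim is then
  \<open>lift_phi\<close>.\<close>

lemma extension_unit: "comp_functor P extension (unit_morphism X P) = \<phi>"
proof -
  have obj: "extension_obj (component (comma X P (omap (proj P) a)) (a, Ident X (omap (proj P) a)))
      = omap \<phi> a" if "a \<in> Obj P" for a
    using that D.transport_Ident[of "omap \<phi> a"] by (simp add: extension_obj phi_simps proj_phi)
  show ?thesis
    unfolding comp_functor_eq_iff[OF phi_functor]
    by (auto simp: omap_unit amap_unit extension_simps unit_component proj_simps P.Dom_closed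
        obj lift_phi)
qed

lemma extension_unique:
  assumes "over_morphism (up X P) D \<psi>" and "comp_functor P \<psi> (unit_morphism X P) = \<phi>"
  shows "\<psi> = extension"
proof -
  have F: "is_functor (up X P) D \<psi>" using assms(1) by (simp add: over_morphism_def)
  have "\<forall>(f, c)\<in>Arr (up X P). amap (proj D) (amap \<psi> (f, c)) = amap (proj (up X P)) (f, c)"
    using assms(1) unfolding over_morphism_def comp_functor_eq_iff[OF is_functor_up_proj] by auto
  then have over: "amap (proj D) (amap \<psi> (f, c)) = f"
    if "f \<in> Arr X" "c \<in> components (comma X P (Dom X f))" for f c
    using that by (auto simp: up_simps)
  \<comment> \<open>Uniqueness of lifts in \<open>D\<close> reduces the arrow part of
    \<open>\<psi>\<close> to its object part.\<close>
  have arr: "amap \<psi> (f, c) = D.lift f (omap \<psi> (Dom X f, c))"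
    if "f \<in> Arr X" "c \<in> components (comma X P (Dom X f))" for f c
    using that is_functorD(2,3)[OF F, of "(f, c)"]
    by (intro D.lift_eqI[symmetric]) (auto simp: up_simps over)
  have unit: "omap \<psi> (omap (unit_morphism X P) a) = omap \<phi> a" if "a \<in> Obj P" for a
    using assms(2) that unfolding comp_functor_eq_iff[OF phi_functor] by blast
  have obj: "omap \<psi> (x, c) = extension_obj c" if c: "c \<in> components (comma X P x)" for x c
  proof -
    obtain a h where ah: "c = component (comma X P x) (a, h)" "a \<in> Obj P" "h \<in> Arr X"
      "Dom X h = omap (proj P) a" "Cod X h = x"
      using c by (rule comma_componentsE)
    \<comment> \<open>\<open>(h, ?e)\<close> is an arrow of \<open>up X P\<close> from the image of
      \<open>a\<close> under the unit to \<open>(x, c)\<close>. Its domain is where the value of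
      \<open>\<psi>\<close> is prescribed, and \<open>arr\<close> makes its image a lift of
      \<open>h\<close>.\<close>
    let ?e = "component (comma X P (omap (proj P) a)) (a, Ident X (omap (proj P) a))"
    have "omap \<psi> (x, c) = Cod D (amap \<psi> (h, ?e))"
      using is_functorD(4)[OF F, of "(h, ?e)"] ah unit_component[of a]
      by (simp add: up_simps component_action_unit)
    also have "\<dots> = transport D h (omap \<phi> a)"
      using arr[of h ?e] unit_component[of a] unit[of a] ah by (simp add: D.transport_eq omap_unit)
    finally show ?thesis by (simp add: ah extension_obj)
  qed
  show ?thesis
    by (rule fctr_eqI[where A = "Obj (up X P)" and B = "Arr (up X P)"])
      (use is_functor_extensional[OF F] is_functor_extensional[OF is_functor_extension] in
        \<open>auto simp: up_simps extension_simps obj arr\<close>)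
qed

end

section \<open>The tensor with a slice\<close>

lemma prod_over_simps:
  "(a, b) \<in> Obj (prod_over P Q) \<longleftrightarrow> a \<in> Obj P \<and> b \<in> Obj Q \<and> omap (proj P) a = omap (proj Q) b"
  "(u, v) \<in> Arr (prod_over P Q) \<longleftrightarrow> u \<in> Arr P \<and> v \<in> Arr Q \<and> amap (proj P) u = amap (proj Q) v"
  "Dom (prod_over P Q) (u, v) = (Dom P u, Dom Q v)"
  "Cod (prod_over P Q) (u, v) = (Cod P u, Cod Q v)"
  by (simp_all add: prod_over_def Let_def)

lemma base_over_simps:
  "Obj (base_over X) = Obj X" "Arr (base_over X) = Arr X"
  "Dom (base_over X) = Dom X" "Cod (base_over X) = Cod X"
  "y \<in> Obj X \<Longrightarrow> omap (proj (base_over X)) y = y"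
  "f \<in> Arr X \<Longrightarrow> amap (proj (base_over X)) f = f"
  by (simp_all add: base_over_def id_functor_def)

text \<open>The projection of the slice passes through the identity functor of \<open>X\<close>. The
  last two rules are conditional because projections are \<open>undefined\<close> outside the
  category.\<close>

lemma slice_simps:
  "(y, h) \<in> Obj (slice X x) \<longleftrightarrow> y \<in> Obj X \<and> h \<in> Arr X \<and> Dom X h = y \<and> Cod X h = x"
  "((y, h), v, (z, k)) \<in> Arr (slice X x) \<longleftrightarrow>
     (y, h) \<in> Obj (slice X x) \<and> (z, k) \<in> Obj (slice X x) \<and>
     v \<in> Arr X \<and> Dom X v = y \<and> Cod X v = z \<and> k \<cdot>\<^bsub>X\<^esub> v = h"
  "Dom (slice X x) (s, v, t) = s"
  "Cod (slice X x) (s, v, t) = t"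
  "(y, h) \<in> Obj (slice X x) \<Longrightarrow> omap (proj (slice X x)) (y, h) = y"
  "(s, v, t) \<in> Arr (slice X x) \<Longrightarrow> amap (proj (slice X x)) (s, v, t) = v"
proof -
  show *: "(y, h) \<in> Obj (slice X x) \<longleftrightarrow> y \<in> Obj X \<and> h \<in> Arr X \<and> Dom X h = y \<and> Cod X h = x"
    for y h by (auto simp: slice_def comma_simps base_over_simps)
  show arr: "((y, h), v, (z, k)) \<in> Arr (slice X x) \<longleftrightarrow>
     (y, h) \<in> Obj (slice X x) \<and> (z, k) \<in> Obj (slice X x) \<and>
     v \<in> Arr X \<and> Dom X v = y \<and> Cod X v = z \<and> k \<cdot>\<^bsub>X\<^esub> v = h" for y h v z k
    unfolding slice_def comma_simps(2) base_over_simps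
    by (intro conj_cong refl) (simp add: base_over_simps)
  show "Dom (slice X x) (s, v, t) = s" "Cod (slice X x) (s, v, t) = t"
    by (simp_all add: slice_def comma_simps)
  show "omap (proj (slice X x)) (y, h) = y" if "(y, h) \<in> Obj (slice X x)"
    using that * by (simp add: slice_def comma_simps(5) base_over_simps)
  show "amap (proj (slice X x)) (s, v, t) = v" if "(s, v, t) \<in> Arr (slice X x)"
  proof -
    have "v \<in> Arr X" using that arr by (metis surj_pair)
    then show ?thesis using that by (simp add: slice_def comma_simps(6) base_over_simps)
  qed
qed

context over_category
begin

text \<open>The product over \<open>X\<close> forces \<open>y\<close> to be the projection of
  \<open>a\<close>, so \<open>y\<close> carries no information beyond \<open>(a, h)\<close>.\<close>

lemma slice_prod_Obj_iff:
  "((y, h), a) \<in> Obj (prod_over (slice X x) P) \<longleftrightarrow>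
    (a, h) \<in> Obj (comma X P x) \<and> y = omap (proj P) a"
proof
  assume "((y, h), a) \<in> Obj (prod_over (slice X x) P)"
  then show "(a, h) \<in> Obj (comma X P x) \<and> y = omap (proj P) a"
    using slice_simps(5)[of y h X x] by (simp add: prod_over_simps comma_simps(1)) (simp add: slice_simps(1))
next
  assume "(a, h) \<in> Obj (comma X P x) \<and> y = omap (proj P) a"
  then show "((y, h), a) \<in> Obj (prod_over (slice X x) P)"
    by (simp add: prod_over_simps comma_simps(1) slice_simps(1,5) proj_simps)
qed

text \<open>Likewise for arrows: the slice component is forced to be the projection of
  \<open>u\<close>, leaving exactly an arrow of the comma category.\<close>

lemma slice_prod_ArrE:
  assumes "e \<in> Arr (prod_over (slice X x) P)"
  obtains u h k where "((Dom P u, h), u, (Cod P u, k)) \<in> Arr (comma X P x)"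
    "e = (((omap (proj P) (Dom P u), h), amap (proj P) u, (omap (proj P) (Cod P u), k)), u)"
proof -
  obtain y h v z k u where e: "e = (((y, h), v, (z, k)), u)"
    by (metis prod.exhaust)
  have slice: "((y, h), v, (z, k)) \<in> Arr (slice X x)" and u: "u \<in> Arr P" "v = amap (proj P) u"
    using assms slice_simps(6)[of "(y, h)" v "(z, k)" X x] by (simp_all add: e prod_over_simps)
  then have yz: "y = omap (proj P) (Dom P u)" "z = omap (proj P) (Cod P u)"
    by (simp_all add: slice_simps(2) proj_simps)
  have "((Dom P u, h), u, (Cod P u, k)) \<in> Arr (comma X P x)"
    using slice u yz by (simp add: slice_simps(1,2) comma_simps(1,2) P.Dom_closed P.Cod_closed)
  then show thesis by (rule that) (simp add: e u yz)
qed

lemma slice_prod_ArrI: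
  assumes "((Dom P u, h), u, (Cod P u, k)) \<in> Arr (comma X P x)"
  shows "(((omap (proj P) (Dom P u), h), amap (proj P) u, (omap (proj P) (Cod P u), k)), u)
    \<in> Arr (prod_over (slice X x) P)"
  using assms by (simp add: prod_over_simps comma_simps(1,2) slice_simps(1,2,6) proj_simps)

text \<open>The product of the slice with \<open>P\<close> and the comma category differ only by the
  redundant data, which \<open>?m\<close> drops and \<open>?n\<close> restores. Arrows correspond in
  both directions, so the components do as well.\<close>

lemma ten_slice_bij:
  obtains \<theta> where "bij_betw \<theta> (ten (slice X x) P) (components (comma X P x))"
    and "\<And>a h. (a, h) \<in> Obj (comma X P x) \<Longrightarrow>
      \<theta> (component (prod_over (slice X x) P) ((omap (proj P) a, h), a)) = component (comma X P x) (a, h)"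
proof -
  let ?m = "\<lambda>((y, h), a). (a, h)" and ?n = "\<lambda>(a, h). ((omap (proj P) a, h), a)"
  let ?T = "prod_over (slice X x) P" and ?C = "comma X P x"
  have m_arr: "component ?C (?m (Dom ?T e)) = component ?C (?m (Cod ?T e))" if "e \<in> Arr ?T" for e
  proof -
    obtain u h k where "((Dom P u, h), u, (Cod P u, k)) \<in> Arr ?C"
      and e: "e = (((omap (proj P) (Dom P u), h), amap (proj P) u, (omap (proj P) (Cod P u), k)), u)"
      using \<open>e \<in> Arr ?T\<close> by (rule slice_prod_ArrE)
    from component_Dom_Cod[OF this(1)] show ?thesis
      by (simp add: e prod_over_simps slice_simps(3,4) comma_simps(3,4))
  qed
  have n_arr: "component ?T (?n (Dom ?C e)) = component ?T (?n (Cod ?C e))" if "e \<in> Arr ?C" for e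
  proof -
    obtain a h u b k where e: "e = ((a, h), u, (b, k))"
      by (metis prod.exhaust)
    with that have ab: "a = Dom P u" "b = Cod P u" by (simp_all add: comma_simps)
    from component_Dom_Cod[OF slice_prod_ArrI[of u h k]] that show ?thesis
      by (simp add: e prod_over_simps slice_simps(3,4) comma_simps(3,4) ab)
  qed
  show ?thesis
  proof (rule components_bij_betw[of ?T ?m ?C ?n])
    show "?m s \<in> Obj ?C" "?n (?m s) = s" if "s \<in> Obj ?T" for s
      using that by (cases s; cases "fst s"; simp add: slice_prod_Obj_iff)+
    show "?n t \<in> Obj ?T" "?m (?n t) = t" if "t \<in> Obj ?C" for t
      using that by (cases t; simp add: slice_prod_Obj_iff)+
    fix \<theta>
    assume "bij_betw \<theta> (components ?T) (components ?C)"
      and \<theta>: "\<And>s. s \<in> Obj ?T \<Longrightarrow> \<theta> (component ?T s) = component ?C (?m s)"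
    then have "bij_betw \<theta> (ten (slice X x) P) (components ?C)"
      by (simp add: ten_def)
    then show thesis
      by (rule that) (simp add: \<theta> slice_prod_Obj_iff)
  qed (fact m_arr n_arr)+
qed

lemma ten_slice_fiber_up:
  assumes "x \<in> Obj X"
  shows "\<exists>\<theta>. bij_betw \<theta> (ten (slice X x) P) (fiber (up X P) x) \<and>
    (\<forall>(a, h)\<in>Obj (comma X P x).
      \<theta> (component (prod_over (slice X x) P) ((omap (proj P) a, h), a))
        = (x, component (comma X P x) (a, h)))"
proof (rule ten_slice_bij[of x])
  fix \<theta>
  assume \<theta>: "bij_betw \<theta> (ten (slice X x) P) (components (comma X P x))"
    "\<And>a h. (a, h) \<in> Obj (comma X P x) \<Longrightarrow>
      \<theta> (component (prod_over (slice X x) P) ((omap (proj P) a, h), a)) = component (comma X P x) (a, h)"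
  \<comment> \<open>Objects of \<open>up X P\<close> are components tagged with their base object,
    so the fiber is reached by adding the tag \<open>x\<close>.\<close>
  have "bij_betw (Pair x) (components (comma X P x)) (fiber (up X P) x)"
    by (auto simp: fiber_up[OF assms] bij_betw_def inj_on_def)
  from bij_betw_trans[OF \<theta>(1) this] show ?thesis
    by (intro exI[of _ "Pair x \<circ> \<theta>"]) (auto simp: \<theta>(2))
qed

end

theorem proposition23:
  fixes X :: "('xo, 'xa) cat"
    and P :: "('po, 'pa, 'xo, 'xa) over"
  assumes "category X" and "category_over X P"
  shows "discrete_opfibration X (up X P)
    \<and> (\<forall>x\<in>Obj X. fiber (up X P) x = {x} \<times> components (comma X P x))
    \<and> (\<forall>f\<in>Arr X. \<forall>(a, h)\<in>Obj (comma X P (Dom X f)).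
         transport (up X P) f (Dom X f, component (comma X P (Dom X f)) (a, h))
           = (Cod X f, component (comma X P (Cod X f)) (a, f \<cdot>\<^bsub>X\<^esub> h)))
    \<and> over_morphism P (up X P) (unit_morphism X P)
    \<and> (\<forall>x\<in>Obj X. \<forall>a\<in>fiber P x.
         omap (unit_morphism X P) a = (x, component (comma X P x) (a, Ident X x)))
    \<and> (\<forall>(D :: ('do, 'da, 'xo, 'xa) over) \<phi>.
         discrete_opfibration X D \<and> over_morphism P D \<phi> \<longrightarrow>
         (\<exists>!\<psi>. over_morphism (up X P) D \<psi> \<and> comp_functor P \<psi> (unit_morphism X P) = \<phi>))
    \<and> (\<forall>x\<in>Obj X. \<exists>\<theta>.
         bij_betw \<theta> (ten (slice X x) P) (fiber (up X P) x) \<and>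
         (\<forall>(a, h)\<in>Obj (comma X P x).
            \<theta> (component (prod_over (slice X x) P) ((omap (proj P) a, h), a))
              = (x, component (comma X P x) (a, h))))"
proof -
  interpret over_category X P
    using assms by (simp add: over_category_iff)
  have universal: "\<exists>!\<psi>. over_morphism (up X P) D \<psi> \<and> comp_functor P \<psi> (unit_morphism X P) = \<phi>"
    if "discrete_opfibration X D" "over_morphism P D \<phi>"
    for D :: "('do, 'da, 'xo, 'xa) over" and \<phi>
  proof -
    interpret D: discrete_opfibration_over X D
      using that(1) assms(1) by (simp add: discrete_opfibration_iff)
    interpret morphism_to_discrete_opfibration X P D \<phi>
      by unfold_locales (fact that(2))
    show ?thesis
      using over_morphism_extension extension_unit extension_unique by blast
  qed
  show ?thesis
  proof (intro conjI)
    show "\<forall>f\<in>Arr X. \<forall>(a, h)\<in>Obj (comma X P (Dom X f)).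
         transport (up X P) f (Dom X f, component (comma X P (Dom X f)) (a, h))
           = (Cod X f, component (comma X P (Cod X f)) (a, f \<cdot>\<^bsub>X\<^esub> h))"
      by (auto simp: transport_up)
    show "\<forall>x\<in>Obj X. \<forall>a\<in>fiber P x.
         omap (unit_morphism X P) a = (x, component (comma X P x) (a, Ident X x))"
      by (auto simp: fiber_def omap_unit)
    show "\<forall>x\<in>Obj X. \<exists>\<theta>. bij_betw \<theta> (ten (slice X x) P) (fiber (up X P) x) \<and>
        (\<forall>(a, h)\<in>Obj (comma X P x).
          \<theta> (component (prod_over (slice X x) P) ((omap (proj P) a, h), a))
            = (x, component (comma X P x) (a, h)))"
      by (intro ballI ten_slice_fiber_up)
  qed (simp_all add: discrete_opfibration_up fiber_up over_morphism_unit universal)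
qed

end
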